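(* Let $R$ be an associative ring with identity. The following are equivalent: (1) $R$ is von Neumann regular; (2) for every $n\ge 1$, every element $(B\,|\,A)$ of $L'_n(R)$ is equivalent (under $\approx_n$) to a system; (3) every element $(B\,|\,A)$ of $L'_1(R)$ is equivalent (under $\approx_1$) to a system.
   Context: $R$ is an associative, not necessarily commutative, ring with identity; it is von Neumann regular if for every $r\in R$ there is $s\in R$ with $rsr=r$. For $n\ge 1$, $L'_n(R)$ is the collection of pairs $(B\,|\,A)$ of matrices with entries in $R$ such that $A$ has $n$ columns and $B$ has the same number of rows as $A$ (the number of rows, and the number of columns of $B$, are arbitrary). The relation $(B\,|\,A)\le_n (B'\,|\,A')$ holds in $L'_n(R)$ if there exist matrices $U,V,G$ over $R$, of appropriate size, such that $UB=B'V$ and $UA=A'+B'G$. This is a pre-order; write $(B\,|\,A)\approx_n(B'\,|\,A')$ (equivalent) if both $(B\,|\,A)\le_n(B'\,|\,A')$ and $(B'\,|\,A')\le_n(B\,|\,A)$. An element of $L'_n(R)$ is called a (homogeneous) system if it is of the form $(\mathbf 0\,|\,A)$, where $\mathbf 0$ is a zero matrix. *)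

theory Defs
  imports "Jordan_Normal_Form.Matrix"
begin

text \<open>
  The ring is given by a type of sort \<open>{ring, monoid_mult}\<close>: an associative, possibly noncommutative
  ring with identity. The class \<open>ring_1\<close> would in addition demand \<open>0 \<noteq> 1\<close>, excluding the trivial ring.
\<close>

definition von_neumann_regular :: "'a::{ring, monoid_mult} itself \<Rightarrow> bool" where
  "von_neumann_regular _ \<longleftrightarrow> (\<forall>r::'a. \<exists>s. r * s * r = r)"

text \<open>
  A pair \<open>(B, A)\<close> stands for \<open>(B | A)\<close>. The number of rows and the number of columns of \<open>B\<close> may be \<open>0\<close>.
\<close>

definition Lprime :: "nat \<Rightarrow> ('a mat \<times> 'a mat) set" where
  "Lprime n = {(B, A). dim_col A = n \<and> dim_row B = dim_row A}"

text \<open>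
  The product of matrices is total, so the sizes that make the equations meaningful are stated
  explicitly.
\<close>

definition Lprime_le ::
    "nat \<Rightarrow> 'a::{ring, monoid_mult} mat \<times> 'a mat \<Rightarrow> 'a mat \<times> 'a mat \<Rightarrow> bool" where
  "Lprime_le n = (\<lambda>(B, A) (B', A').
     (B, A) \<in> Lprime n \<and> (B', A') \<in> Lprime n \<and>
     (\<exists>U \<in> carrier_mat (dim_row A') (dim_row A).
      \<exists>V \<in> carrier_mat (dim_col B') (dim_col B).
      \<exists>G \<in> carrier_mat (dim_col B') n.
        U * B = B' * V \<and> U * A = A' + B' * G))"

definition Lprime_equiv ::
    "nat \<Rightarrow> 'a::{ring, monoid_mult} mat \<times> 'a mat \<Rightarrow> 'a mat \<times> 'a mat \<Rightarrow> bool" where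
  "Lprime_equiv n P Q \<longleftrightarrow> Lprime_le n P Q \<and> Lprime_le n Q P"

definition systems :: "nat \<Rightarrow> ('a::{ring, monoid_mult} mat \<times> 'a mat) set" where
  "systems n = {(B, A) \<in> Lprime n. B = 0\<^sub>m (dim_row B) (dim_col B)}"

end

theory Submission
  imports Defs
begin

text \<open>
  Call \<open>C\<close> an inner inverse of \<open>B\<close> if \<open>B C B = B\<close>. Both implications come from comparing such
  inverses with systems.

  If \<open>C\<close> is an inner inverse of \<open>B\<close>, then \<open>P = 1 - B C\<close> satisfies \<open>P B = 0\<close>, so left multiplication by
  \<open>P\<close> shows \<open>(B | A) \<le> (0 | P A)\<close>. Conversely \<open>P A = A + B (- C A)\<close> differs from \<open>A\<close> only by a multiple
  of \<open>B\<close>, so \<open>(0 | P A) \<le> (B | A)\<close>. Hence \<open>(B | A)\<close> is equivalent to a system as soon as \<open>B\<close> has an inner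
  inverse (\<open>Lprime_equiv_system_if_inner_inverse\<close>), and over a von Neumann regular ring every
  rectangular matrix has one (\<open>von_neumann_regular_imp_inner_inverse_mat\<close>). For the latter, McCoy's
  identity lets one replace \<open>B\<close> by \<open>B - B E B\<close> for any \<open>E\<close>. If \<open>E\<close> has a single nonzero entry, at the
  transposed position of an entry of \<open>B\<close> and inverse to it in the sense of regularity, then this
  replacement clears that entry. Clearing the entries row by row never
  disturbs the zeros obtained before and ends in the zero matrix.

  For the way back, take \<open>r\<close> in the ring and let \<open>(0 | A)\<close> be a system equivalent to \<open>(r | 1)\<close>. One
  inequality gives \<open>A r = 0\<close>, the other gives \<open>U A = 1 + r g\<close> for some \<open>U\<close> and \<open>g\<close>. Multiplication by \<open>r\<close>
  on the right yields \<open>0 = r + r g r\<close>, so \<open>- g\<close> is the element that regularity asks of \<open>r\<close>.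
\<close>

section \<open>Inner inverses of matrices\<close>

text \<open>
  The unit law over \<open>semiring_1\<close> assumes \<open>0 \<noteq> 1\<close>, while the trivial ring is a regular ring too.
\<close>

lemma one_mat_mult_left:
  fixes A :: "'a::{ring, monoid_mult} mat"
  assumes "A \<in> carrier_mat m n"
  shows "1\<^sub>m m * A = A"
proof (rule eq_matI)
  fix i j assume ij: "i < dim_row A" "j < dim_col A"
  have "(1\<^sub>m m * A) $$ (i, j) = (\<Sum>k\<in>{0..<m}. (if i = k then 1 else 0) * A $$ (k, j))"
    using ij assms by (auto simp: scalar_prod_def intro!: sum.cong)
  also have "\<dots> = (\<Sum>k\<in>{0..<m}. if i = k then A $$ (k, j) else 0)"
    by (intro sum.cong) auto
  also have "\<dots> = A $$ (i, j)"
    using ij assms by (simp add: sum.delta')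
  finally show "(1\<^sub>m m * A) $$ (i, j) = A $$ (i, j)" .
qed (use assms in auto)

text \<open>
  McCoy's identity: \<open>B = X + B E B\<close>, and \<open>X Y X\<close> is itself of the form \<open>B Z B\<close> because \<open>X\<close> is both a
  left and a right multiple of \<open>B\<close>.
\<close>

lemma inner_inverse_mat_if_residual:
  fixes B E Y :: "'a::ring mat"
  assumes B: "B \<in> carrier_mat m n" and E: "E \<in> carrier_mat n m" and Y: "Y \<in> carrier_mat n m"
    and X: "X = B - B * E * B" and inv: "X * Y * X = X"
  shows "\<exists>C \<in> carrier_mat n m. B * C * B = B"
proof -
  define D where "D = Y - E * B * Y"
  define Z where "Z = D - D * B * E"
  have D: "D \<in> carrier_mat n m" and Z: "Z \<in> carrier_mat n m"
    using B E Y by (auto simp: D_def Z_def)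
  have Xc: "X \<in> carrier_mat m n"
    using B E by (auto simp: X)
  have BD: "B * D = X * Y"
  proof -
    have "B * D = B * Y - B * (E * B * Y)"
      unfolding D_def by (rule mult_minus_distrib_mat) (use B E Y in auto)
    also have "B * (E * B * Y) = B * (E * B) * Y"
      by (rule assoc_mult_mat[symmetric]) (use B E Y in auto)
    also have "B * (E * B) = B * E * B"
      by (rule assoc_mult_mat[symmetric]) (use B E in auto)
    also have "B * Y - B * E * B * Y = X * Y"
      unfolding X by (rule minus_mult_distrib_mat[symmetric]) (use B E Y in auto)
    finally show ?thesis .
  qed
  have "B * Z = B * D - B * (D * B * E)"
    unfolding Z_def by (rule mult_minus_distrib_mat) (use B E D in auto)
  also have "B * (D * B * E) = B * (D * (B * E))"
    by (subst assoc_mult_mat) (use B D E in auto)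
  also have "\<dots> = B * D * (B * E)"
    by (rule assoc_mult_mat[symmetric]) (use B D E in auto)
  finally have "B * Z * B = (B * D - B * D * (B * E)) * B"
    by simp
  also have "\<dots> = B * D * B - B * D * (B * E) * B"
    by (rule minus_mult_distrib_mat) (use B D E in auto)
  also have "B * D * (B * E) * B = B * D * (B * E * B)"
    by (rule assoc_mult_mat) (use B D E in auto)
  also have "B * D * B - B * D * (B * E * B) = B * D * X"
    unfolding X by (rule mult_minus_distrib_mat[symmetric]) (use B D E in auto)
  also have "\<dots> = X"
    by (simp add: BD inv)
  finally have BZB: "B * Z * B = X" .
  have "B * (Z + E) * B = (B * Z + B * E) * B"
    using mult_add_distrib_mat[OF B Z E] by simp
  also have "\<dots> = B * Z * B + B * E * B"
    by (rule add_mult_distrib_mat) (use B Z E in auto)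
  also have "\<dots> = X + B * E * B"
    by (simp add: BZB)
  also have "\<dots> = B"
    using B E by (intro eq_matI) (auto simp: X)
  finally have "B * (Z + E) * B = B" .
  then show ?thesis
    using Z E by (intro bexI[of _ "Z + E"]) auto
qed

lemma mult_single_entry_mult_mat:
  fixes X :: "'a::ring mat" and s :: 'a
  assumes X: "X \<in> carrier_mat m n" and i: "i < m" and j: "j < n" and k: "k < m" and l: "l < n"
  defines "E \<equiv> mat n m (\<lambda>(a, b). if a = j \<and> b = i then s else 0)"
  shows "(X * E * X) $$ (k, l) = X $$ (k, j) * s * X $$ (i, l)"
proof -
  have XE: "(X * E) $$ (k, b) = (if b = i then X $$ (k, j) * s else 0)" if "b < m" for b
  proof -
    have "(X * E) $$ (k, b) = (\<Sum>a\<in>{0..<n}. X $$ (k, a) * (if a = j \<and> b = i then s else 0))"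
      using X k that by (auto simp: E_def scalar_prod_def intro!: sum.cong)
    also have "\<dots> = (\<Sum>a\<in>{0..<n}. if a = j then (if b = i then X $$ (k, j) * s else 0) else 0)"
      by (intro sum.cong) auto
    finally show ?thesis
      using j by (simp add: sum.delta)
  qed
  have "(X * E * X) $$ (k, l) = (\<Sum>b\<in>{0..<m}. (X * E) $$ (k, b) * X $$ (b, l))"
    using X k l by (auto simp: E_def scalar_prod_def intro!: sum.cong)
  also have "\<dots> = (\<Sum>b\<in>{0..<m}. if b = i then X $$ (k, j) * s * X $$ (i, l) else 0)"
    by (intro sum.cong) (auto simp: XE)
  finally show ?thesis
    using i by (simp add: sum.delta)
qed

text \<open>
  The position \<open>(k, l)\<close> has number \<open>k * n + l\<close> in the row-major order. Clearing the entry at \<open>(i, j)\<close>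
  subtracts \<open>X k j * s * X i l\<close> at \<open>(k, l)\<close>. At an earlier position either \<open>k < i\<close>, and then the left
  factor vanishes already, or \<open>k = i\<close> and \<open>l < j\<close>, and then the right factor does. This order therefore
  preserves the zeros.
\<close>

lemma von_neumann_regular_imp_inner_inverse_mat:
  fixes B :: "'a::{ring, monoid_mult} mat"
  assumes reg: "von_neumann_regular TYPE('a)" and B: "B \<in> carrier_mat m n"
  shows "\<exists>C \<in> carrier_mat n m. B * C * B = B"
proof -
  define P where "P t \<longleftrightarrow> (\<forall>X \<in> carrier_mat m n.
    (\<forall>k<m. \<forall>l<n. k * n + l < t \<longrightarrow> X $$ (k, l) = (0::'a)) \<longrightarrow>
    (\<exists>C \<in> carrier_mat n m. X * C * X = X))" for t
  have "P 0"
  proof (rule inc_induct[of 0 "m * n"])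
    show "P (m * n)"
      unfolding P_def
    proof (intro ballI impI)
      fix X :: "'a mat"
      assume X: "X \<in> carrier_mat m n"
        and zero: "\<forall>k<m. \<forall>l<n. k * n + l < m * n \<longrightarrow> X $$ (k, l) = 0"
      have "k * n + l < m * n" if "k < m" "l < n" for k l
      proof -
        have "k * n + l < Suc k * n"
          using that by simp
        also have "\<dots> \<le> m * n"
          using that by (intro mult_le_mono1) simp
        finally show ?thesis .
      qed
      then have "X = 0\<^sub>m m n"
        using X zero by (intro eq_matI) auto
      then show "\<exists>C \<in> carrier_mat n m. X * C * X = X"
        by (intro bexI[of _ "0\<^sub>m n m"]) auto
    qed
  next
    fix t assume t: "t < m * n" and IH: "P (Suc t)"
    show "P t"
      unfolding P_def
    proof (intro ballI impI)
      fix X :: "'a mat"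
      assume X: "X \<in> carrier_mat m n"
        and zero: "\<forall>k<m. \<forall>l<n. k * n + l < t \<longrightarrow> X $$ (k, l) = 0"
      define i j where "i = t div n" and "j = t mod n"
      have n: "0 < n"
        using t by (cases n) auto
      have i: "i < m" and j: "j < n" and tij: "t = i * n + j"
        using t n by (auto simp: i_def j_def less_mult_imp_div_less)
      obtain s where s: "X $$ (i, j) * s * X $$ (i, j) = X $$ (i, j)"
        using reg unfolding von_neumann_regular_def by blast
      define E where "E = mat n m (\<lambda>(a, b). if a = j \<and> b = i then s else 0)"
      have E: "E \<in> carrier_mat n m"
        by (simp add: E_def)
      define X' where "X' = X - X * E * X"
      have X': "X' \<in> carrier_mat m n"
        using X E by (auto simp: X'_def)
      have "X' $$ (k, l) = 0" if k: "k < m" and l: "l < n" and kl: "k * n + l < Suc t" for k l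
      proof -
        have entry: "X' $$ (k, l) = X $$ (k, l) - X $$ (k, j) * s * X $$ (i, l)"
          using X E k l mult_single_entry_mult_mat[OF X i j k l, of s]
          by (simp add: X'_def E_def)
        consider "k < i" | "k = i" "l < j" | "k = i" "l = j" | "i < k"
          using kl tij by (cases k i rule: linorder_cases) (auto simp: less_Suc_eq)
        then show ?thesis
        proof cases
          case 1
          have row: "k * n + b < t" if "b < n" for b
          proof -
            have "k * n + b < Suc k * n"
              using that by simp
            also have "\<dots> \<le> i * n"
              using 1 by (intro mult_le_mono1) simp
            finally show ?thesis
              using tij by simp
          qed
          show ?thesis
            using zero k l j row unfolding entry by simp
        next
          case 2
          then show ?thesis
            using zero k l tij unfolding entry by simp
        next
          case 3
          then show ?thesis
            unfolding entry by (simp add: s)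
        next
          case 4
          then have "Suc i * n \<le> k * n"
            by (intro mult_le_mono1) simp
          then show ?thesis
            using kl tij j by simp
        qed
      qed
      then obtain Y where "Y \<in> carrier_mat n m" "X' * Y * X' = X'"
        using IH X' unfolding P_def by blast
      then show "\<exists>C \<in> carrier_mat n m. X * C * X = X"
        using inner_inverse_mat_if_residual[OF X E] X'_def by blast
    qed
  qed simp
  then show ?thesis
    using B by (simp add: P_def)
qed

section \<open>Inner inverses and systems\<close>

lemma Lprime_leI:
  assumes "A \<in> carrier_mat m n" "B \<in> carrier_mat m p"
    and "A' \<in> carrier_mat m' n" "B' \<in> carrier_mat m' p'"
    and "U \<in> carrier_mat m' m" "V \<in> carrier_mat p' p" "G \<in> carrier_mat p' n"
    and "U * B = B' * V" "U * A = A' + B' * G"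
  shows "Lprime_le n (B, A) (B', A')"
proof -
  have "dim_row A = m" "dim_col A = n" "dim_row B = m" "dim_col B = p"
    "dim_row A' = m'" "dim_col A' = n" "dim_row B' = m'" "dim_col B' = p'"
    using assms(1-4) by (blast dest: carrier_matD)+
  then show ?thesis
    unfolding Lprime_le_def Lprime_def using assms(5-9) by blast
qed

lemma Lprime_leE:
  assumes "Lprime_le n (B, A) (B', A')"
    and "A \<in> carrier_mat m n" "B \<in> carrier_mat m p"
    and "A' \<in> carrier_mat m' n" "B' \<in> carrier_mat m' p'"
  obtains U V G where "U \<in> carrier_mat m' m" "V \<in> carrier_mat p' p" "G \<in> carrier_mat p' n"
    and "U * B = B' * V" "U * A = A' + B' * G"
proof -
  have "dim_row A = m" "dim_col B = p" "dim_row A' = m'" "dim_col B' = p'"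
    using assms(2-5) by (blast dest: carrier_matD)+
  then show ?thesis
    using assms(1) that unfolding Lprime_le_def by blast
qed

text \<open>
  The system is \<open>(0 | (1 - B C) A)\<close>: left multiplication by \<open>1 - B C\<close> annihilates \<open>B\<close> and changes \<open>A\<close>
  only by a multiple of \<open>B\<close>.
\<close>

lemma Lprime_equiv_system_if_inner_inverse:
  fixes A B C :: "'a::{ring, monoid_mult} mat"
  assumes A: "A \<in> carrier_mat m n" and B: "B \<in> carrier_mat m p" and C: "C \<in> carrier_mat p m"
    and inv: "B * C * B = B"
  shows "\<exists>S \<in> systems n. Lprime_equiv n (B, A) S"
proof -
  define P where "P = 1\<^sub>m m - B * C"
  have P: "P \<in> carrier_mat m m"
    using B C by (auto simp: P_def)
  have "P * B = 1\<^sub>m m * B - B * C * B"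
    unfolding P_def by (rule minus_mult_distrib_mat) (use B C in auto)
  then have PB: "P * B = 0\<^sub>m m p"
    using B by (simp add: one_mat_mult_left[OF B] inv)
  have PA: "P * A = A + B * (- (C * A))"
  proof -
    have "P * A = 1\<^sub>m m * A - B * C * A"
      unfolding P_def by (rule minus_mult_distrib_mat) (use A B C in auto)
    also have "\<dots> = A - B * (C * A)"
      using A B C by (simp add: one_mat_mult_left[OF A] assoc_mult_mat[OF B C A])
    also have "\<dots> = A + - (B * (C * A))"
      using A B C by (intro add_uminus_minus_mat[symmetric]) auto
    also have "- (B * (C * A)) = B * (- (C * A))"
      using A B C by (intro uminus_mult_right_mat[symmetric]) auto
    finally show ?thesis .
  qed
  define S where "S = (0\<^sub>m m p :: 'a mat, P * A)"
  have le: "Lprime_le n (B, A) S"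
    unfolding S_def
  proof (rule Lprime_leI[OF A B _ _ P])
    show "P * B = 0\<^sub>m m p * 0\<^sub>m p p"
      by (simp add: PB)
    show "P * A = P * A + 0\<^sub>m m p * 0\<^sub>m p n"
      using A P by simp
  qed (use A P in auto)
  have ge: "Lprime_le n S (B, A)"
    unfolding S_def
  proof (rule Lprime_leI[OF _ _ A B one_carrier_mat])
    show "1\<^sub>m m * 0\<^sub>m m p = B * 0\<^sub>m p p"
      using B by (simp add: one_mat_mult_left)
    show "1\<^sub>m m * (P * A) = A + B * (- (C * A))"
      using one_mat_mult_left[OF mult_carrier_mat[OF P A]] PA by (rule trans)
  qed (use A C P in auto)
  have "S \<in> systems n"
    using A P by (auto simp: S_def systems_def Lprime_def)
  then show ?thesis
    using le ge unfolding Lprime_equiv_def by blast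
qed

text \<open>
  The pair \<open>(r | 1)\<close> expresses divisibility by \<open>r\<close> of an unknown. A system \<open>(0 | A)\<close> below it makes \<open>1\<close>
  a left multiple of \<open>A\<close> up to a right multiple of \<open>r\<close>; a system above it has \<open>A r = 0\<close>.
\<close>

lemma system_equiv_imp_regular_element:
  fixes r :: "'a::{ring, monoid_mult}"
  defines "M \<equiv> \<lambda>x::'a. mat 1 1 (\<lambda>_. x)"
  assumes S: "S \<in> systems 1" and equiv: "Lprime_equiv 1 (M r, M 1) S"
  shows "\<exists>s. r * s * r = r"
proof -
  have M: "M x \<in> carrier_mat 1 1" for x
    by (simp add: M_def)
  obtain B A where S_BA: "S = (B, A)"
    by (cases S)
  define k p where "k = dim_row B" and "p = dim_col B"
  have B: "B = 0\<^sub>m k p" and A: "A \<in> carrier_mat k 1"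
    using S unfolding S_BA systems_def Lprime_def k_def p_def by (auto intro: carrier_matI)
  have S_eq: "S = (0\<^sub>m k p, A)"
    using S_BA B by simp
  have le: "Lprime_le 1 (M r, M 1) (0\<^sub>m k p, A)" and ge: "Lprime_le 1 (0\<^sub>m k p, A) (M r, M 1)"
    using equiv by (simp_all add: S_eq Lprime_equiv_def)
  obtain U V G where U: "U \<in> carrier_mat k 1" and V: "V \<in> carrier_mat p 1"
    and G: "G \<in> carrier_mat p 1" and UB: "U * M r = 0\<^sub>m k p * V"
    and UA: "U * M 1 = A + 0\<^sub>m k p * G"
    using le M M A zero_carrier_mat by (rule Lprime_leE)
  have "U * M 1 = U"
    using U by (intro eq_matI) (auto simp: M_def scalar_prod_def)
  then have "A = U"
    using UA A G by simp
  then have Ar: "A * M r = 0\<^sub>m k 1"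
    using UB V by simp
  obtain U' V' G' where U': "U' \<in> carrier_mat 1 k" and G': "G' \<in> carrier_mat 1 1"
    and U'A: "U' * A = M 1 + M r * G'"
    using ge A zero_carrier_mat M M by (rule Lprime_leE)
  define g where "g = G' $$ (0, 0)"
  have "U' * A * M r = U' * (A * M r)"
    using U' A M by (rule assoc_mult_mat)
  then have "(M 1 + M r * G') * M r = 0\<^sub>m 1 1"
    using U' by (simp add: Ar U'A)
  then have "((M 1 + M r * G') * M r) $$ (0, 0) = 0"
    by simp
  then have "(1 + r * g) * r = 0"
    using G' by (simp add: M_def g_def scalar_prod_def)
  then have "r * (- g) * r = r"
    by (simp add: algebra_simps add_eq_0_iff)
  then show ?thesis ..
qed

theorem corollary12:
  shows "(von_neumann_regular TYPE('a::{ring, monoid_mult}) \<longleftrightarrow>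
            (\<forall>n\<ge>1. \<forall>P \<in> (Lprime n :: ('a mat \<times> 'a mat) set). \<exists>S \<in> systems n. Lprime_equiv n P S)) \<and>
         (von_neumann_regular TYPE('a) \<longleftrightarrow>
            (\<forall>P \<in> (Lprime 1 :: ('a mat \<times> 'a mat) set). \<exists>S \<in> systems 1. Lprime_equiv 1 P S))"
proof -
  have reg_imp: "\<exists>S \<in> systems n. Lprime_equiv n P S"
    if reg: "von_neumann_regular TYPE('a)" and P: "P \<in> Lprime n" for n and P :: "'a mat \<times> 'a mat"
  proof -
    obtain B A where BA: "P = (B, A)"
      by (cases P)
    have A: "A \<in> carrier_mat (dim_row A) n" and B: "B \<in> carrier_mat (dim_row A) (dim_col B)"
      using P by (auto simp: BA Lprime_def)
    obtain C where "C \<in> carrier_mat (dim_col B) (dim_row A)" "B * C * B = B"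
      using von_neumann_regular_imp_inner_inverse_mat[OF reg B] by blast
    then show ?thesis
      using Lprime_equiv_system_if_inner_inverse[OF A B] by (simp add: BA)
  qed
  have reg: "von_neumann_regular TYPE('a)"
    if sys: "\<forall>P \<in> (Lprime 1 :: ('a mat \<times> 'a mat) set). \<exists>S \<in> systems 1. Lprime_equiv 1 P S"
    unfolding von_neumann_regular_def
  proof
    fix r :: 'a
    have "(mat 1 1 (\<lambda>_. r), mat 1 1 (\<lambda>_. 1)) \<in> Lprime 1"
      by (simp add: Lprime_def)
    then show "\<exists>s. r * s * r = r"
      using sys system_equiv_imp_regular_element by blast
  qed
  show ?thesis
    using reg_imp reg by (meson order_refl)
qed

end
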